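(* Let $F(\bm{\lambda})=\sum_{i\in[I]}a_i\prod_{j\in[p]}\lambda_j^{n_{i,j}}$ on $\mathbb{R}^p$ with $a_i\in\mathbb{R}$ and nonnegative integers $n_{i,j}$, let $K>\max\{F(\bm{\lambda}):\bm{1}^\top\bm{\lambda}=1,\ \bm{\lambda}\ge\bm{0}\}$, and let $f(\bm{\theta})=-\ln\big(K-F(\theta_1,\ldots,\theta_{p-1},1-\bm{1}^\top\bm{\theta})\big)$ on $\Theta=\{\bm{\theta}\in\mathbb{R}^{p-1}:\bm{\theta}\ge\bm{0},\ \bm{1}^\top\bm{\theta}\le1\}$. Let $m\in\mathbb{N}$ with $m\ge\max\{\sum_{j\in[p]}n_{i,j}:i\in[I]\}$. If the multinomial distribution $$p_{\bm{x}}(\bm{\theta})=\frac{m!}{x_1!\cdots x_{p-1}!(m-\bm{1}^\top\bm{x})!}\prod_{j\in[p-1]}\theta_j^{x_j}(1-\bm{1}^\top\bm{\theta})^{m-\bm{1}^\top\bm{x}},\qquad \bm{x}\in(\{0\}\cup\mathbb{N})^{p-1},\ \bm{1}^\top\bm{x}\le m,$$ is employed in the EM algorithm for minimizing $f$ over $\Theta$, then the natural gradient update formula $\bm{\theta}^{(t)}=\bm{\theta}^{(t-1)}-\bm{I}_{p_{\bm{x}}}(\bm{\theta}^{(t-1)})^{-1}\nabla f(\bm{\theta}^{(t-1)})$ results in $$\theta_j^{(t)}=\theta_j^{(t-1)}-\frac{\theta_j^{(t-1)}}{m}\Big(\frac{\partial}{\partial\theta_j}f(\bm{\theta}^{(t-1)})-V^{(t-1)}\Big),\quad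 j\in[p-1],\qquad V^{(t-1)}:=\sum_{j\in[p-1]}\theta_j^{(t-1)}\frac{\partial}{\partial\theta_j}f(\bm{\theta}^{(t-1)}).$$
   Context: $[n]:=\{1,\ldots,n\}$; $\bm{1}$ is the all-ones vector of appropriate dimension. EM algorithm for minimizing $f$ over $\Theta$: given a parametric probability mass function $p_{\bm{x}}(\bm{\theta})$ and a positive function $G$ with $f(\bm{\theta})=-\ln\mathbb{E}_{p_{\bm{x}}(\bm{\theta})}[G(\bm{X})]$ on $\mathrm{int}\,\Theta$, start at $\bm{\theta}^{(0)}\in\mathrm{int}\,\Theta$ and iterate $\bm{\theta}^{(t)}\in\arg\min_{\bm{\theta}\in\Theta}\{-\sum_{\bm{x}}q_{\bm{x}}(\bm{\theta}^{(t-1)})\ln(G(\bm{x})p_{\bm{x}}(\bm{\theta}))\}$, where $q_{\bm{x}}(\bm{\theta})=G(\bm{x})p_{\bm{x}}(\bm{\theta})/\mathbb{E}_{p_{\bm{x}}(\bm{\theta})}[G(\bm{X})]$; the natural gradient update formula in the claim is the one giving the stationary point of this minimization. Fisher information matrix: $\bm{I}_{p_{\bm{x}}}(\bm{\theta}):=\mathbb{E}_{p_{\bm{x}}(\bm{\theta})}[\nabla\ln p_{\bm{X}}(\bm{\theta})\nabla\ln p_{\bm{X}}(\bm{\theta})^\top]$ (gradients in $\bm{\theta}\in\mathbb{R}^{p-1}$). *)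

theory Defs
  imports "HOL-Analysis.Analysis"
begin

text \<open>
  Points of \<open>\<real>\<^sup>p\<close> are indexed by \<^typ>\<open>'n option\<close> and points of \<open>\<real>\<^sup>p\<^sup>-\<^sup>1\<close> by \<^typ>\<open>'n\<close>,
  so \<open>p = CARD('n) + 1 \<ge> 2\<close>; the index \<^term>\<open>None\<close> is the \<open>p\<close>-th coordinate.
\<close>

definition poly_fun ::
  "nat \<Rightarrow> (nat \<Rightarrow> real) \<Rightarrow> (nat \<Rightarrow> 'k::finite \<Rightarrow> nat) \<Rightarrow> real^'k \<Rightarrow> real" where
  "poly_fun I a N l = (\<Sum>i\<in>{1..I}. a i * (\<Prod>j\<in>UNIV. (l $ j) ^ N i j))"

definition unit_simplex :: "(real^'k::finite) set" where
  "unit_simplex = {l. (\<Sum>j\<in>UNIV. l $ j) = 1 \<and> (\<forall>j. 0 \<le> l $ j)}"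

definition solid_simplex :: "(real^'n::finite) set" where
  "solid_simplex = {\<theta>. (\<forall>j. 0 \<le> \<theta> $ j) \<and> (\<Sum>j\<in>UNIV. \<theta> $ j) \<le> 1}"

definition complete_point :: "real^'n::finite \<Rightarrow> real^('n option)" where
  "complete_point \<theta> = (\<chi> k. case k of Some j \<Rightarrow> \<theta> $ j | None \<Rightarrow> 1 - (\<Sum>j\<in>UNIV. \<theta> $ j))"

definition log_objective ::
  "nat \<Rightarrow> (nat \<Rightarrow> real) \<Rightarrow> (nat \<Rightarrow> 'n::finite option \<Rightarrow> nat) \<Rightarrow> real \<Rightarrow> real^'n \<Rightarrow> real" where
  "log_objective I a N K \<theta> = - ln (K - poly_fun I a N (complete_point \<theta>))"

definition partial_deriv :: "'n::finite \<Rightarrow> (real^'n \<Rightarrow> real) \<Rightarrow> real^'n \<Rightarrow> real" where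
  "partial_deriv j f \<theta> = deriv (\<lambda>s. f (\<theta> + s *\<^sub>R axis j 1)) 0"

definition gradient :: "(real^'n::finite \<Rightarrow> real) \<Rightarrow> real^'n \<Rightarrow> real^'n" where
  "gradient f \<theta> = (\<chi> j. partial_deriv j f \<theta>)"

text \<open>
  A parametric probability mass function is a map \<open>p\<close> with \<open>p \<theta> x\<close> the mass of the outcome \<open>x\<close>,
  together with the finite set \<open>X\<close> of outcomes. It is kept as a plain function, rather than as a
  \<open>pmf\<close>, because it is differentiated in \<open>\<theta>\<close>.
\<close>

definition expect ::
  "'x set \<Rightarrow> (real^'n::finite \<Rightarrow> 'x \<Rightarrow> real) \<Rightarrow> real^'n \<Rightarrow> ('x \<Rightarrow> real) \<Rightarrow> real" where
  "expect X p \<theta> h = (\<Sum>x\<in>X. p \<theta> x * h x)"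

definition fisher_information ::
  "'x set \<Rightarrow> (real^'n::finite \<Rightarrow> 'x \<Rightarrow> real) \<Rightarrow> real^'n \<Rightarrow> real^'n^'n" where
  "fisher_information X p \<theta> =
     (\<chi> i j. expect X p \<theta> (\<lambda>x. gradient (\<lambda>\<eta>. ln (p \<eta> x)) \<theta> $ i * gradient (\<lambda>\<eta>. ln (p \<eta> x)) \<theta> $ j))"

definition natural_gradient_update ::
  "'x set \<Rightarrow> (real^'n::finite \<Rightarrow> 'x \<Rightarrow> real) \<Rightarrow> (real^'n \<Rightarrow> real) \<Rightarrow> real^'n \<Rightarrow> real^'n" where
  "natural_gradient_update X p f \<theta> =
     \<theta> - matrix_inv (fisher_information X p \<theta>) *v gradient f \<theta>"

definition em_weight ::
  "'x set \<Rightarrow> (real^'n::finite \<Rightarrow> 'x \<Rightarrow> real) \<Rightarrow> ('x \<Rightarrow> real) \<Rightarrow> real^'n \<Rightarrow> 'x \<Rightarrow> real" where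
  "em_weight X p G \<theta> x = G x * p \<theta> x / expect X p \<theta> G"

text \<open>
  On the boundary of the parameter set some masses vanish and the objective of the EM step is
  \<open>+\<infinity>\<close>. The library's convention \<open>ln 0 = 0\<close> would create spurious minimizers there, so the
  logarithm is taken with \<open>ln 0 = -\<infinity>\<close>.
\<close>

definition ln_ext :: "real \<Rightarrow> ereal" where
  "ln_ext y = (if 0 < y then ereal (ln y) else -\<infinity>)"

definition em_objective ::
  "'x set \<Rightarrow> (real^'n::finite \<Rightarrow> 'x \<Rightarrow> real) \<Rightarrow> ('x \<Rightarrow> real) \<Rightarrow> real^'n \<Rightarrow> real^'n \<Rightarrow> ereal" where
  "em_objective X p G \<theta>\<^sub>0 \<theta> = - (\<Sum>x\<in>X. ereal (em_weight X p G \<theta>\<^sub>0 x) * ln_ext (G x * p \<theta> x))"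

text \<open>
  \<open>\<theta>\<close> is a run of the EM algorithm for minimizing \<open>f\<close> over \<open>\<Theta>\<close> using \<open>p\<close> and \<open>G\<close>.
\<close>

definition em_run ::
  "(real^'n::finite) set \<Rightarrow> (real^'n \<Rightarrow> real) \<Rightarrow> 'x set \<Rightarrow> (real^'n \<Rightarrow> 'x \<Rightarrow> real) \<Rightarrow>
   ('x \<Rightarrow> real) \<Rightarrow> (nat \<Rightarrow> real^'n) \<Rightarrow> bool" where
  "em_run \<Theta> f X p G \<theta> \<longleftrightarrow>
     (\<forall>x\<in>X. 0 < G x) \<and>
     (\<forall>\<eta>\<in>interior \<Theta>. f \<eta> = - ln (expect X p \<eta> G)) \<and>
     \<theta> 0 \<in> interior \<Theta> \<and>
     (\<forall>t\<ge>1. is_arg_min (em_objective X p G (\<theta> (t - 1))) (\<lambda>\<eta>. \<eta> \<in> \<Theta>) (\<theta> t))"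

definition multinomial_outcomes :: "nat \<Rightarrow> (nat^'n::finite) set" where
  "multinomial_outcomes m = {x. (\<Sum>j\<in>UNIV. x $ j) \<le> m}"

definition multinomial_mass :: "nat \<Rightarrow> real^'n::finite \<Rightarrow> nat^'n \<Rightarrow> real" where
  "multinomial_mass m \<theta> x =
     fact m / ((\<Prod>j\<in>UNIV. fact (x $ j)) * fact (m - (\<Sum>j\<in>UNIV. x $ j)))
     * (\<Prod>j\<in>UNIV. (\<theta> $ j) ^ (x $ j))
     * (1 - (\<Sum>j\<in>UNIV. \<theta> $ j)) ^ (m - (\<Sum>j\<in>UNIV. x $ j))"

end

theory Submission
  imports Defs
begin

text \<open>
  Completing \<open>\<eta>\<close> to a probability vector \<open>t\<close> with \<open>p\<close> coordinates makes the multinomial law symmetric in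
  its \<open>p\<close> counts. Its second moments give the Fisher matrix
  \<open>m (diag(1/\<eta>) + 1 1\<^sup>T / t\<^sub>p)\<close>, whose inverse is \<open>(diag(\<eta>) - \<eta> \<eta>\<^sup>T) / m\<close>; this yields the explicit form of
  the natural gradient update for an arbitrary gradient. In the EM step, let \<open>c\<^sub>k\<close> be the mean of the
  \<open>k\<close>-th count under the weights \<open>q\<close>. Up to a constant, the objective is \<open>- \<Sum>\<^sub>k c\<^sub>k ln t\<^sub>k\<close>, so by
  Gibbs' inequality its unique minimizer is \<open>t\<^sub>k = c\<^sub>k / m\<close>, an interior point. Differentiating
  \<open>- ln E[G]\<close> shows \<open>\<partial>\<^sub>j f = c\<^sub>p / t\<^sub>p - c\<^sub>j / \<eta>\<^sub>j\<close>, and substituting this in the explicit update also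
  gives \<open>c\<^sub>j / m\<close>.
\<close>

section \<open>Multinomial weights in symmetric form and their moments\<close>

definition compositions :: "nat \<Rightarrow> ('k::finite \<Rightarrow> nat) set" where
  "compositions m = {y. (\<Sum>k\<in>UNIV. y k) = m}"

text \<open>The formula makes sense for every \<open>y\<close> and \<open>t\<close>, so the
  recursion below is a purely algebraic identity; the normalization of \<open>t\<close> enters
  through the total mass.\<close>

definition multinomial_weight :: "nat \<Rightarrow> ('k::finite \<Rightarrow> real) \<Rightarrow> ('k \<Rightarrow> nat) \<Rightarrow> real" where
  "multinomial_weight m t y = fact m / (\<Prod>k\<in>UNIV. fact (y k)) * (\<Prod>k\<in>UNIV. t k ^ y k)"

lemma finite_compositions: "finite (compositions m :: ('k::finite \<Rightarrow> nat) set)"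
proof (rule finite_subset)
  have "y k \<le> (\<Sum>k\<in>UNIV. y k)" for y :: "'k \<Rightarrow> nat" and k
    by (rule member_le_sum) auto
  then show "(compositions m :: ('k \<Rightarrow> nat) set) \<subseteq> PiE UNIV (\<lambda>_. {..m})"
    by (auto simp: compositions_def)
qed (auto intro: finite_PiE)

lemma compositions_0: "compositions 0 = {\<lambda>_. 0}"
  by (auto simp: compositions_def)

lemma sum_increment:
  fixes y :: "'k::finite \<Rightarrow> nat"
  shows "(\<Sum>i\<in>UNIV. (y(k := Suc (y k))) i) = Suc (\<Sum>i\<in>UNIV. y i)"
proof -
  have "(y(k := Suc (y k))) i = y i + (if i = k then 1 else 0)" for i
    by simp
  then show ?thesis
    by (simp add: sum.distrib del: fun_upd_apply)
qed

text \<open>The inverse takes one unit away from coordinate \<open>k\<close>;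
  \<open>y k \<noteq> 0\<close> keeps the natural subtraction from truncating. This is the index
  shift behind the moment recursion.\<close>

lemma bij_betw_increment:
  "bij_betw (\<lambda>y. y(k := Suc (y k))) (compositions m) {y \<in> compositions (Suc m). y k \<noteq> 0}"
proof (rule bij_betw_byWitness[where f' = "\<lambda>y. y(k := y k - 1)"])
  have "y(k := y k - 1) \<in> compositions m" if "y \<in> compositions (Suc m)" "y k \<noteq> 0" for y
    using that sum_increment[of "y(k := y k - 1)" k] by (simp add: compositions_def)
  then show "(\<lambda>y. y(k := y k - 1)) ` {y \<in> compositions (Suc m). y k \<noteq> 0} \<subseteq> compositions m"
    by blast
  show "(\<lambda>y. y(k := Suc (y k))) ` compositions m \<subseteq> {y \<in> compositions (Suc m). y k \<noteq> 0}"
    using sum_increment[of _ k] by (auto simp: compositions_def simp del: fun_upd_apply) simp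
qed auto

text \<open>Raising \<open>y k\<close> by one multiplies the product of factorials by
  \<open>Suc (y k)\<close> and the product of powers by \<open>t k\<close>; the factor
  \<open>Suc m\<close> comes from \<open>fact (Suc m)\<close>.\<close>

lemma multinomial_weight_increment:
  "multinomial_weight (Suc m) t (y(k := Suc (y k))) * Suc (y k)
     = real (Suc m) * t k * multinomial_weight m t y"
proof -
  have "(\<Prod>i\<in>UNIV. fact ((y(k := Suc (y k))) i) :: real) = real (Suc (y k)) * (\<Prod>i\<in>UNIV. fact (y i))"
    by (subst (1 2) prod.remove[of UNIV k]) (auto intro!: prod.cong)
  moreover have "(\<Prod>i\<in>UNIV. t i ^ (y(k := Suc (y k))) i) = t k * (\<Prod>i\<in>UNIV. t i ^ y i)"
    by (subst (1 2) prod.remove[of UNIV k]) (auto intro!: prod.cong)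
  ultimately show ?thesis
    unfolding multinomial_weight_def by (simp add: field_simps del: fun_upd_apply of_nat_Suc)
qed

text \<open>All moments of the multinomial distribution, including its total mass, come from this recursion.\<close>

lemma multinomial_moment_Suc:
  "(\<Sum>y\<in>compositions (Suc m). multinomial_weight (Suc m) t y * (real (y k) * h y))
     = real (Suc m) * t k * (\<Sum>y\<in>compositions m. multinomial_weight m t y * h (y(k := Suc (y k))))"
proof -
  have "(\<Sum>y\<in>compositions (Suc m). multinomial_weight (Suc m) t y * (real (y k) * h y))
      = (\<Sum>y\<in>{y \<in> compositions (Suc m). y k \<noteq> 0}. multinomial_weight (Suc m) t y * (real (y k) * h y))"
    by (rule sum.mono_neutral_right) (auto simp: finite_compositions)
  also have "\<dots> = (\<Sum>y\<in>compositions m. (multinomial_weight (Suc m) t (y(k := Suc (y k))) * Suc (y k))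
                    * h (y(k := Suc (y k))))"
    by (subst sum.reindex_bij_betw[OF bij_betw_increment, symmetric]) (simp add: mult.assoc)
  finally show ?thesis
    by (simp only: multinomial_weight_increment sum_distrib_left mult.assoc)
qed

text \<open>The counts sum to \<open>Suc m\<close>, so \<open>Suc m\<close> times the mass is the
  sum of all first moments. The recursion turns each of these into \<open>Suc m * t k\<close> times
  the mass for \<open>m\<close>, which is one by induction.\<close>

lemma multinomial_total:
  assumes "(\<Sum>k\<in>UNIV. t k) = 1"
  shows "(\<Sum>y\<in>compositions m. multinomial_weight m t y) = 1"
proof (induction m)
  case 0
  show ?case
    by (simp add: compositions_0 multinomial_weight_def)
next
  case (Suc m)
  have "real (Suc m) * (\<Sum>y\<in>compositions (Suc m). multinomial_weight (Suc m) t y)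
      = (\<Sum>y\<in>compositions (Suc m). \<Sum>k\<in>UNIV. multinomial_weight (Suc m) t y * (real (y k) * 1))"
  proof -
    have "(\<Sum>k\<in>UNIV. multinomial_weight (Suc m) t y * (real (y k) * 1))
        = real (Suc m) * multinomial_weight (Suc m) t y" if "y \<in> compositions (Suc m)" for y
      using that by (simp add: compositions_def flip: sum_distrib_left of_nat_sum)
    then show ?thesis
      by (simp add: sum_distrib_left)
  qed
  also have "\<dots> = (\<Sum>k\<in>UNIV. real (Suc m) * t k)"
    by (subst sum.swap, subst multinomial_moment_Suc) (simp add: Suc)
  also have "\<dots> = real (Suc m)"
    using assms by (simp flip: sum_distrib_left)
  finally show ?case
    by simp
qed

lemma multinomial_first_moment:
  assumes "(\<Sum>k\<in>UNIV. t k) = 1"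
  shows "(\<Sum>y\<in>compositions m. multinomial_weight m t y * real (y k)) = m * t k"
proof (cases m)
  case (Suc n)
  show ?thesis
    using multinomial_moment_Suc[of n t k "\<lambda>_. 1"] multinomial_total[OF assms, of n] Suc by simp
qed (simp add: compositions_0)

text \<open>The recursion is applied with \<open>h y = y l\<close>. Its shift adds one to
  \<open>y l\<close> exactly when \<open>k = l\<close>, which is the source of the diagonal
  term.\<close>

lemma multinomial_second_moment:
  assumes "(\<Sum>k\<in>UNIV. t k) = 1"
  shows "(\<Sum>y\<in>compositions m. multinomial_weight m t y * (real (y k) * real (y l)))
    = m * (real m - 1) * t k * t l + (if k = l then m * t k else 0)"
proof (cases m)
  case (Suc n)
  have "(\<Sum>y\<in>compositions n. multinomial_weight n t y * real ((y(k := Suc (y k))) l))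
      = (\<Sum>y\<in>compositions n. multinomial_weight n t y * real (y l)
           + (if k = l then multinomial_weight n t y else 0))"
    by (intro sum.cong) (auto simp: algebra_simps)
  also have "\<dots> = n * t l + (if k = l then 1 else 0)"
    using multinomial_first_moment[OF assms, of n l] multinomial_total[OF assms, of n]
    by (simp add: sum.distrib)
  finally show ?thesis
    using multinomial_moment_Suc[of n t k "\<lambda>y. real (y l)"] Suc
    by (simp add: algebra_simps)
qed (simp add: compositions_0)

section \<open>Transfer between outcomes with \<open>p - 1\<close> counts and completed vectors with
  \<open>p\<close> counts\<close>

text \<open>The natural subtraction gives the true remaining count on
  \<open>multinomial_outcomes m\<close>; elsewhere it truncates to zero.\<close>

definition complete_count :: "nat \<Rightarrow> nat^'n::finite \<Rightarrow> 'n option \<Rightarrow> nat" where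
  "complete_count m x k = (case k of Some j \<Rightarrow> x $ j | None \<Rightarrow> m - (\<Sum>j\<in>UNIV. x $ j))"

lemma sum_UNIV_option:
  fixes g :: "'n::finite option \<Rightarrow> 'a::comm_monoid_add"
  shows "(\<Sum>k\<in>UNIV. g k) = g None + (\<Sum>j\<in>UNIV. g (Some j))"
  by (simp add: UNIV_option_conv sum.reindex)

lemma prod_UNIV_option:
  fixes g :: "'n::finite option \<Rightarrow> 'a::comm_monoid_mult"
  shows "(\<Prod>k\<in>UNIV. g k) = g None * (\<Prod>j\<in>UNIV. g (Some j))"
  by (simp add: UNIV_option_conv prod.reindex)

lemma bij_betw_complete_count:
  "bij_betw (complete_count m) (multinomial_outcomes m :: (nat^'n::finite) set) (compositions m)"
proof (rule bij_betw_byWitness[where f' = "\<lambda>y. \<chi> j. y (Some j)"])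
  show "\<forall>y\<in>compositions m. complete_count m (\<chi> j. y (Some j)) = y"
    by (auto simp: compositions_def sum_UNIV_option complete_count_def fun_eq_iff split: option.split)
qed (auto simp: compositions_def sum_UNIV_option complete_count_def multinomial_outcomes_def vec_eq_iff)

lemma multinomial_mass_eq:
  "multinomial_mass m \<eta> x = multinomial_weight m (($) (complete_point \<eta>)) (complete_count m x)"
  by (simp add: multinomial_mass_def multinomial_weight_def prod_UNIV_option complete_count_def
      complete_point_def mult_ac)

lemma sum_complete_point [simp]: "(\<Sum>k\<in>UNIV. complete_point \<eta> $ k) = 1"
  by (simp add: sum_UNIV_option complete_point_def)

lemma sum_complete_count:
  "x \<in> multinomial_outcomes m \<Longrightarrow> (\<Sum>k\<in>UNIV. complete_count m x k) = m"
  by (simp add: sum_UNIV_option complete_count_def multinomial_outcomes_def)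

lemma finite_multinomial_outcomes: "finite (multinomial_outcomes m)"
  using bij_betw_complete_count bij_betw_finite finite_compositions by blast

lemma multinomial_outcomes_nonempty: "multinomial_outcomes m \<noteq> {}"
  by (auto simp: multinomial_outcomes_def intro: exI[of _ 0])

lemma expect_multinomial_second_moment:
  "expect (multinomial_outcomes m) (multinomial_mass m) \<eta>
      (\<lambda>x. real (complete_count m x k) * real (complete_count m x l))
    = m * (real m - 1) * complete_point \<eta> $ k * complete_point \<eta> $ l
      + (if k = l then m * complete_point \<eta> $ k else 0)"
  unfolding expect_def multinomial_mass_eq
  by (subst sum.reindex_bij_betw[OF bij_betw_complete_count,
        where g = "\<lambda>y. multinomial_weight m (($) (complete_point \<eta>)) y * (real (y k) * real (y l))"])
    (rule multinomial_second_moment, simp)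

section \<open>The solid simplex and its interior in completed coordinates\<close>

lemma mem_solid_simplex_iff: "\<eta> \<in> solid_simplex \<longleftrightarrow> (\<forall>k. 0 \<le> complete_point \<eta> $ k)"
  by (auto simp: solid_simplex_def complete_point_def split: option.split)

lemma mem_interior_solid_simplex_iff:
  fixes \<eta> :: "real^'n::finite"
  shows "\<eta> \<in> interior solid_simplex \<longleftrightarrow> (\<forall>k. 0 < complete_point \<eta> $ k)"
proof -
  have Basis: "Basis = range (\<lambda>i. axis i 1 :: real^'n)" "inj (\<lambda>i. axis i 1 :: real^'n)"
    by (auto simp: Basis_vec_def inj_on_def axis_eq_axis)
  \<comment> \<open>As the hull of the origin and the standard basis, the set has an interior given
    by \<open>interior_std_simplex\<close>.\<close>
  have hull: "(solid_simplex :: (real^'n) set) = convex hull (insert 0 Basis)"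
    unfolding std_simplex solid_simplex_def unfolding Basis(1)
    by (simp add: sum.reindex[OF Basis(2)] inner_axis)
  have "interior (solid_simplex :: (real^'n) set) = {\<eta>. (\<forall>j. 0 < \<eta> $ j) \<and> (\<Sum>j\<in>UNIV. \<eta> $ j) < 1}"
    unfolding hull interior_std_simplex unfolding Basis(1)
    by (simp add: sum.reindex[OF Basis(2)] inner_axis)
  then show ?thesis
    by (auto simp: complete_point_def split: option.split)
qed

section \<open>Derivatives of the multinomial mass and of its logarithm\<close>

text \<open>The derivative of the \<open>k\<close>-th completed coordinate in direction
  \<open>axis i 1\<close>: the last coordinate loses what coordinate \<open>i\<close> gains.\<close>

definition score_coeff :: "'n \<Rightarrow> 'n option \<Rightarrow> real" where
  "score_coeff i k = (case k of Some j \<Rightarrow> if i = j then 1 else 0 | None \<Rightarrow> -1)"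

text \<open>Completion is affine in the parameter, so the formula is exact for every
  \<open>s\<close> and not merely to first order.\<close>

lemma complete_point_shift:
  "complete_point (\<eta> + s *\<^sub>R axis i 1) $ k = complete_point \<eta> $ k + s * score_coeff i k"
proof -
  have "(\<Sum>j\<in>UNIV. axis i (1::real) $ j) = 1"
    by (simp add: axis_def)
  then have "(\<Sum>j\<in>UNIV. (\<eta> + s *\<^sub>R axis i 1) $ j) = (\<Sum>j\<in>UNIV. \<eta> $ j) + s"
    by (simp add: sum.distrib flip: sum_distrib_left)
  then show ?thesis
    by (auto simp: complete_point_def score_coeff_def axis_def split: option.split)
qed

lemma sum_mult_score_coeff:
  fixes i :: "'n::finite"
  shows "(\<Sum>k\<in>UNIV. g k * score_coeff i k) = g (Some i) - g None"
  by (simp add: sum_UNIV_option score_coeff_def if_distrib cong: if_cong)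

lemma sum_score_coeff [simp]:
  fixes i :: "'n::finite"
  shows "(\<Sum>k\<in>UNIV. score_coeff i k) = 0"
  using sum_mult_score_coeff[of "\<lambda>_. 1" i] by simp

text \<open>The score, that is, the \<open>i\<close>-th partial derivative of the log-mass, written
  over all \<open>p\<close> completed coordinates.\<close>

definition multinomial_score :: "nat \<Rightarrow> real^'n::finite \<Rightarrow> 'n \<Rightarrow> nat^'n \<Rightarrow> real" where
  "multinomial_score m \<eta> i x =
     (\<Sum>k\<in>UNIV. real (complete_count m x k) * score_coeff i k / complete_point \<eta> $ k)"

lemma multinomial_mass_pos:
  assumes "\<eta> \<in> interior solid_simplex"
  shows "0 < multinomial_mass m \<eta> x"
  using assms unfolding mem_interior_solid_simplex_iff multinomial_mass_eq multinomial_weight_def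
  by (intro mult_pos_pos divide_pos_pos prod_pos zero_less_power) simp_all

lemma ln_multinomial_mass:
  assumes "\<eta> \<in> interior solid_simplex"
  shows "ln (multinomial_mass m \<eta> x) = ln (fact m / (\<Prod>k\<in>UNIV. fact (complete_count m x k)))
    + (\<Sum>k\<in>UNIV. complete_count m x k * ln (complete_point \<eta> $ k))"
proof -
  have pos: "0 < complete_point \<eta> $ k" for k
    using assms by (simp add: mem_interior_solid_simplex_iff)
  then have "complete_point \<eta> $ k \<noteq> 0" for k
    by (metis less_irrefl)
  with pos have "ln (\<Prod>k\<in>UNIV. complete_point \<eta> $ k ^ complete_count m x k)
      = (\<Sum>k\<in>UNIV. complete_count m x k * ln (complete_point \<eta> $ k))"
    by (subst ln_prod) (auto simp: ln_realpow)
  moreover have "0 < (\<Prod>k\<in>UNIV. complete_point \<eta> $ k ^ complete_count m x k)"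
    using pos by (intro prod_pos) auto
  moreover have "0 < fact m / (\<Prod>k\<in>UNIV. fact (complete_count m x k) :: real)"
    by (intro divide_pos_pos prod_pos) auto
  ultimately show ?thesis
    unfolding multinomial_mass_eq multinomial_weight_def by (simp only: ln_mult_pos)
qed

text \<open>Lets a formula valid on the interior alone be differentiated at \<open>s = 0\<close>,
  since a derivative depends only on nearby values.\<close>

lemma eventually_shift_interior:
  fixes \<eta> :: "real^'n::finite"
  assumes "\<eta> \<in> interior S"
  shows "\<forall>\<^sub>F s in nhds (0::real). \<eta> + s *\<^sub>R v \<in> interior S"
proof -
  have "((\<lambda>s::real. \<eta> + s *\<^sub>R v) \<longlongrightarrow> \<eta> + 0 *\<^sub>R v) (nhds 0)"
    by (intro tendsto_intros filterlim_ident)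
  then show ?thesis
    using topological_tendstoD[of _ "\<eta> + 0 *\<^sub>R v" "nhds 0" "interior S"] assms by simp
qed

lemma has_real_derivative_ln_multinomial_mass:
  assumes "\<eta> \<in> interior solid_simplex"
  shows "((\<lambda>s. ln (multinomial_mass m (\<eta> + s *\<^sub>R axis i 1) x)) has_real_derivative
           multinomial_score m \<eta> i x) (at 0)"
proof -
  let ?t = "complete_point \<eta>"
  have pos: "0 < ?t $ k" for k
    using assms by (simp add: mem_interior_solid_simplex_iff)
  have "((\<lambda>s. ln (fact m / (\<Prod>k\<in>UNIV. fact (complete_count m x k)))
      + (\<Sum>k\<in>UNIV. complete_count m x k * ln (?t $ k + s * score_coeff i k)))
      has_real_derivative multinomial_score m \<eta> i x) (at 0)"
    unfolding multinomial_score_def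
    by (auto intro!: derivative_eq_intros sum.cong simp: pos)
  moreover have "\<forall>\<^sub>F s in nhds 0. ln (multinomial_mass m (\<eta> + s *\<^sub>R axis i 1) x)
      = ln (fact m / (\<Prod>k\<in>UNIV. fact (complete_count m x k)))
        + (\<Sum>k\<in>UNIV. complete_count m x k * ln (?t $ k + s * score_coeff i k))"
    using eventually_shift_interior[OF assms, of "axis i 1"]
    by eventually_elim (simp add: ln_multinomial_mass complete_point_shift)
  ultimately show ?thesis
    by (subst DERIV_cong_ev[OF refl _ refl])
qed

text \<open>Near \<open>s = 0\<close> the mass is positive and equals the exponential of its
  logarithm, so its derivative is the mass times the score.\<close>

lemma has_real_derivative_multinomial_mass:
  assumes "\<eta> \<in> interior solid_simplex"
  shows "((\<lambda>s. multinomial_mass m (\<eta> + s *\<^sub>R axis i 1) x) has_real_derivative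
           multinomial_mass m \<eta> x * multinomial_score m \<eta> i x) (at 0)"
proof -
  have "((\<lambda>s. exp (ln (multinomial_mass m (\<eta> + s *\<^sub>R axis i 1) x))) has_real_derivative
           multinomial_mass m \<eta> x * multinomial_score m \<eta> i x) (at 0)"
    using DERIV_fun_exp[OF has_real_derivative_ln_multinomial_mass[OF assms, of m i x]]
      multinomial_mass_pos[OF assms, of m x] by simp
  moreover have "\<forall>\<^sub>F s in nhds 0. multinomial_mass m (\<eta> + s *\<^sub>R axis i 1) x
      = exp (ln (multinomial_mass m (\<eta> + s *\<^sub>R axis i 1) x))"
    using eventually_shift_interior[OF assms, of "axis i 1"]
    by eventually_elim (simp add: multinomial_mass_pos)
  ultimately show ?thesis
    by (subst DERIV_cong_ev[OF refl _ refl])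
qed

section \<open>The Fisher information matrix, its inverse and the explicit natural gradient
  update\<close>

lemma gradient_ln_multinomial_mass:
  assumes "\<eta> \<in> interior solid_simplex"
  shows "gradient (\<lambda>\<eta>. ln (multinomial_mass m \<eta> x)) \<eta> $ i = multinomial_score m \<eta> i x"
  using has_real_derivative_ln_multinomial_mass[OF assms]
  by (simp add: gradient_def partial_deriv_def DERIV_imp_deriv)

text \<open>
  The coefficients of each score sum to zero, so only the diagonal part of the second moments
  survives.
\<close>

lemma fisher_information_multinomial:
  assumes "\<eta> \<in> interior solid_simplex"
  shows "fisher_information (multinomial_outcomes m) (multinomial_mass m) \<eta> $ i $ j
    = m * ((if i = j then 1 / \<eta> $ i else 0) + 1 / complete_point \<eta> $ None)"
proof -
  let ?t = "complete_point \<eta>"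
  let ?d = "\<lambda>i k. score_coeff i k / ?t $ k"
  have pos: "0 < ?t $ k" for k
    using assms by (simp add: mem_interior_solid_simplex_iff)
  then have nz: "?t $ k \<noteq> 0" for k
    by (metis less_irrefl)
  have "fisher_information (multinomial_outcomes m) (multinomial_mass m) \<eta> $ i $ j
      = (\<Sum>x\<in>multinomial_outcomes m. \<Sum>k\<in>UNIV. \<Sum>l\<in>UNIV. ?d i k * ?d j l *
           (multinomial_mass m \<eta> x * (real (complete_count m x k) * real (complete_count m x l))))"
    unfolding fisher_information_def expect_def gradient_ln_multinomial_mass[OF assms] vec_lambda_beta
      multinomial_score_def sum_product
    unfolding sum_distrib_left by (simp add: mult_ac)
  also have "\<dots> = (\<Sum>k\<in>UNIV. \<Sum>l\<in>UNIV. ?d i k * ?d j l *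
      (m * (real m - 1) * ?t $ k * ?t $ l + (if k = l then m * ?t $ k else 0)))"
    unfolding expect_multinomial_second_moment[symmetric] expect_def sum_distrib_left
    by (subst sum.swap) (intro sum.cong refl sum.swap)
  \<comment> \<open>Cancelling the coordinates leaves in the off-diagonal part a constant times a
    product of coefficients, which then factors into two vanishing sums.\<close>
  also have "\<dots> = (\<Sum>k\<in>UNIV. \<Sum>l\<in>UNIV. m * (real m - 1) * (score_coeff i k * score_coeff j l)
      + (if k = l then m * (score_coeff i k * score_coeff j k / ?t $ k) else 0))"
    by (intro sum.cong refl) (auto simp: nz field_simps)
  also have "\<dots> = m * (real m - 1) * ((\<Sum>k\<in>UNIV. score_coeff i k) * (\<Sum>l\<in>UNIV. score_coeff j l))
      + (\<Sum>k\<in>UNIV. m * (score_coeff i k * score_coeff j k / ?t $ k))"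
    unfolding sum_product unfolding sum_distrib_left sum.distrib by simp
  also have "\<dots> = (\<Sum>k\<in>UNIV. m * score_coeff i k / ?t $ k * score_coeff j k)"
    by (simp add: mult_ac)
  also have "\<dots> = m * ((if i = j then 1 / \<eta> $ i else 0) + 1 / ?t $ None)"
    unfolding sum_mult_score_coeff by (simp add: score_coeff_def complete_point_def distrib_left)
  finally show ?thesis .
qed

text \<open>For square matrices a right inverse is two-sided, so the inverse picked by choice in
  \<open>matrix_inv\<close> must be \<open>B\<close>.\<close>

lemma right_inverse_imp_invertible_matrix_inv:
  fixes A B :: "real^'n::finite^'n"
  assumes "A ** B = mat 1"
  shows "invertible A" "matrix_inv A = B"
proof -
  show inv: "invertible A"
    using assms invertible_right_inverse by blast
  then have "matrix_inv A ** A = mat 1"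
    unfolding invertible_def matrix_inv_def by (rule someI2_ex) auto
  then show "matrix_inv A = B"
    using assms by (metis matrix_mul_assoc matrix_mul_lid matrix_mul_rid)
qed

lemma natural_gradient_update_multinomial:
  fixes \<eta> :: "real^'n::finite"
  assumes "\<eta> \<in> interior solid_simplex" and "1 \<le> m"
  defines "A \<equiv> fisher_information (multinomial_outcomes m) (multinomial_mass m) \<eta>"
  shows "invertible A"
    and "natural_gradient_update (multinomial_outcomes m) (multinomial_mass m) f \<eta> $ j =
      \<eta> $ j - \<eta> $ j / real m *
        (partial_deriv j f \<eta> - (\<Sum>k\<in>UNIV. \<eta> $ k * partial_deriv k f \<eta>))"
proof -
  \<comment> \<open>The candidate inverse is the covariance matrix of \<open>x / m\<close> under the
    multinomial law.\<close>
  define B :: "real^'n^'n" where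
    "B = (\<chi> i j. (if i = j then \<eta> $ i / m else 0) - \<eta> $ i * \<eta> $ j / m)"
  have pos: "0 < complete_point \<eta> $ k" for k
    using assms by (simp add: mem_interior_solid_simplex_iff)
  have nz: "\<eta> $ i \<noteq> 0" for i
    using pos[of "Some i"] by (simp add: complete_point_def)
  have nz0: "1 - (\<Sum>k\<in>UNIV. \<eta> $ k) \<noteq> 0"
    using pos[of None] by (simp add: complete_point_def)
  have "(A ** B) $ i $ j = mat 1 $ i $ j" for i j
  proof -
    let ?s = "\<Sum>k\<in>UNIV. \<eta> $ k"
    have "(A ** B) $ i $ j = (\<Sum>k\<in>UNIV. ((if i = k then 1 / \<eta> $ i else 0) + 1 / (1 - ?s))
        * ((if k = j then \<eta> $ j else 0) - \<eta> $ k * \<eta> $ j))"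
      using assms(2) unfolding A_def B_def matrix_matrix_mult_def
      by (auto simp: fisher_information_multinomial[OF assms(1)] complete_point_def field_simps
          intro!: sum.cong)
    also have "\<dots> = (\<Sum>k\<in>UNIV. (if i = k then (if k = j then \<eta> $ j else 0) / \<eta> $ i - \<eta> $ j else 0)
        + ((if k = j then \<eta> $ j / (1 - ?s) else 0) - \<eta> $ k * (\<eta> $ j / (1 - ?s))))"
      by (intro sum.cong refl) (auto simp: nz algebra_simps add_divide_distrib diff_divide_distrib)
    also have "\<dots> = (if i = j then \<eta> $ j else 0) / \<eta> $ i - \<eta> $ j
        + (\<eta> $ j / (1 - ?s) - ?s * (\<eta> $ j / (1 - ?s)))"
      by (simp add: sum.distrib sum_subtractf sum_distrib_right sum_divide_distrib)
    \<comment> \<open>The constant part of the Fisher matrix contributes \<open>\<eta> $ j\<close>,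
      which cancels the term \<open>- \<eta> $ j\<close> from its diagonal part and leaves the
      identity matrix.\<close>
    also have "\<eta> $ j / (1 - ?s) - ?s * (\<eta> $ j / (1 - ?s)) = (1 - ?s) * (\<eta> $ j / (1 - ?s))"
      by (simp only: left_diff_distrib mult_1_left)
    also have "\<dots> = \<eta> $ j"
      using nz0 by simp
    finally show ?thesis
      by (simp add: mat_def nz)
  qed
  then have AB: "A ** B = mat 1"
    by (simp add: vec_eq_iff)
  show "invertible A"
    using right_inverse_imp_invertible_matrix_inv[OF AB] by simp
  have "(B *v gradient f \<eta>) $ j = (\<Sum>k\<in>UNIV. (if j = k then \<eta> $ j / m * partial_deriv k f \<eta> else 0)
      - \<eta> $ j / m * (\<eta> $ k * partial_deriv k f \<eta>))"
    unfolding matrix_vector_mult_def B_def gradient_def vec_lambda_beta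
    by (intro sum.cong refl) (auto simp: algebra_simps)
  also have "\<dots> = \<eta> $ j / m * (partial_deriv j f \<eta> - (\<Sum>k\<in>UNIV. \<eta> $ k * partial_deriv k f \<eta>))"
    by (simp add: sum_subtractf algebra_simps sum_distrib_left sum_divide_distrib)
  finally show "natural_gradient_update (multinomial_outcomes m) (multinomial_mass m) f \<eta> $ j =
      \<eta> $ j - \<eta> $ j / real m *
        (partial_deriv j f \<eta> - (\<Sum>k\<in>UNIV. \<eta> $ k * partial_deriv k f \<eta>))"
    unfolding natural_gradient_update_def
      right_inverse_imp_invertible_matrix_inv(2)[OF AB, unfolded A_def] by simp
qed

section \<open>Gibbs' inequality and sums of extended reals\<close>

text \<open>Use \<open>ln u - ln v \<le> (u - v) / v\<close>, strict for
  \<open>u \<noteq> v\<close>, with \<open>u = t l\<close> and \<open>v = c l / M\<close>. Weighted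
  by \<open>c l\<close>, the right-hand sides become \<open>M * t l - c l\<close> and sum to zero,
  so a single unequal coordinate contradicts \<open>le\<close>.\<close>

lemma gibbs_maximizer_unique:
  fixes c t :: "'k::finite \<Rightarrow> real"
  assumes "\<And>k. 0 < c k" and "\<And>k. 0 < t k"
    and "(\<Sum>k\<in>UNIV. t k) = 1" and M: "(\<Sum>k\<in>UNIV. c k) = M"
    and le: "(\<Sum>k\<in>UNIV. c k * ln (c k / M)) \<le> (\<Sum>k\<in>UNIV. c k * ln (t k))"
  shows "t k = c k / M"
proof (rule ccontr)
  assume neq: "t k \<noteq> c k / M"
  have "0 < M"
    unfolding M[symmetric] by (intro sum_pos) (auto simp: assms)
  have eq: "c l * ((t l - c l / M) / (c l / M)) = M * t l - c l" for l
    using \<open>0 < M\<close> assms(1)[of l] by (simp add: field_simps)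
  have "(\<Sum>l\<in>UNIV. c l * (ln (t l) - ln (c l / M))) < (\<Sum>l\<in>UNIV. M * t l - c l)"
  proof (rule sum_strict_mono_ex1)
    have "c l * (ln (t l) - ln (c l / M)) \<le> c l * ((t l - c l / M) / (c l / M))" for l
      using assms(1,2)[of l] \<open>0 < M\<close> by (intro mult_left_mono ln_diff_le) auto
    then show "\<forall>l\<in>UNIV. c l * (ln (t l) - ln (c l / M)) \<le> M * t l - c l"
      unfolding eq by blast
    have "c k * (ln (t k) - ln (c k / M)) < c k * ((t k - c k / M) / (c k / M))"
      using assms(1,2)[of k] \<open>0 < M\<close> neq by (intro mult_strict_left_mono ln_diff_less) auto
    then show "\<exists>l\<in>UNIV. c l * (ln (t l) - ln (c l / M)) < M * t l - c l"
      unfolding eq by blast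
  qed simp
  also have "\<dots> = 0"
    using assms(3) M by (simp add: sum_subtractf flip: sum_distrib_left)
  finally show False
    using le by (simp add: right_diff_distrib sum_subtractf)
qed

text \<open>In \<open>ereal\<close> the sum of both infinities is \<open>\<infinity>\<close>, so
  \<open>-\<infinity>\<close> absorbs the other summands only when none of them is
  \<open>\<infinity>\<close>.\<close>

lemma sum_ereal_eq_MInfty:
  fixes g :: "'a \<Rightarrow> ereal"
  assumes "finite A" "\<And>x. x \<in> A \<Longrightarrow> g x \<noteq> \<infinity>" "x \<in> A" "g x = -\<infinity>"
  shows "sum g A = -\<infinity>"
proof -
  have "sum g (A - {x}) \<noteq> \<infinity>"
    using assms by (auto simp: sum_Pinfty)
  then show ?thesis
    using assms by (simp add: sum.remove[of A x])
qed

section \<open>The EM step for the multinomial law\<close>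

text \<open>The number \<open>c\<close> of the overview: the posterior mean of the
  \<open>k\<close>-th count, through which alone the EM objective depends on the current iterate up
  to an additive constant.\<close>

definition mean_count :: "nat \<Rightarrow> (nat^'n::finite \<Rightarrow> real) \<Rightarrow> real^'n \<Rightarrow> 'n option \<Rightarrow> real" where
  "mean_count m G \<eta> k = (\<Sum>x\<in>multinomial_outcomes m.
     em_weight (multinomial_outcomes m) (multinomial_mass m) G \<eta> x * complete_count m x k)"

context
  fixes m :: nat and G :: "nat^'n::finite \<Rightarrow> real" and \<eta> :: "real^'n"
  assumes G_pos: "\<And>x. x \<in> multinomial_outcomes m \<Longrightarrow> 0 < G x"
    and interior: "\<eta> \<in> interior solid_simplex"
    and m_pos: "1 \<le> m"
begin

lemma expect_multinomial_pos: "0 < expect (multinomial_outcomes m) (multinomial_mass m) \<eta> G"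
  unfolding expect_def
  by (intro sum_pos finite_multinomial_outcomes multinomial_outcomes_nonempty mult_pos_pos
      multinomial_mass_pos interior G_pos)

lemma em_weight_multinomial_pos:
  "x \<in> multinomial_outcomes m \<Longrightarrow> 0 < em_weight (multinomial_outcomes m) (multinomial_mass m) G \<eta> x"
  unfolding em_weight_def
  by (intro divide_pos_pos mult_pos_pos expect_multinomial_pos multinomial_mass_pos interior G_pos)

lemma sum_em_weight_multinomial:
  "(\<Sum>x\<in>multinomial_outcomes m. em_weight (multinomial_outcomes m) (multinomial_mass m) G \<eta> x) = 1"
proof -
  have "(\<Sum>x\<in>multinomial_outcomes m. G x * multinomial_mass m \<eta> x)
      = expect (multinomial_outcomes m) (multinomial_mass m) \<eta> G"
    by (simp add: expect_def mult.commute)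
  then show ?thesis
    using expect_multinomial_pos by (simp add: em_weight_def flip: sum_divide_distrib)
qed

text \<open>All \<open>m\<close> trials fall into category \<open>k\<close>. This outcome makes the
  mean counts positive and detects a vanishing coordinate on the boundary.\<close>

lemma ex_concentrated_outcome:
  obtains x :: "nat^'n" where "x \<in> multinomial_outcomes m" "complete_count m x k = m"
proof -
  have "(\<lambda>l. if l = k then m else 0) \<in> complete_count m ` (multinomial_outcomes m :: (nat^'n) set)"
    by (simp add: bij_betw_imp_surj_on[OF bij_betw_complete_count] compositions_def)
  then obtain x :: "nat^'n" where "x \<in> multinomial_outcomes m"
      "complete_count m x = (\<lambda>l. if l = k then m else 0)"
    by auto
  then show ?thesis
    using that[of x] by simp
qed

lemma mean_count_pos: "0 < mean_count m G \<eta> k"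
proof -
  obtain x :: "nat^'n" where "x \<in> multinomial_outcomes m" "complete_count m x k = m"
    by (rule ex_concentrated_outcome)
  then show ?thesis
    unfolding mean_count_def using em_weight_multinomial_pos m_pos
    by (intro sum_pos2[of _ x]) (auto simp: finite_multinomial_outcomes less_imp_le)
qed

lemma sum_mean_count: "(\<Sum>k\<in>UNIV. mean_count m G \<eta> k) = m"
proof -
  let ?w = "em_weight (multinomial_outcomes m) (multinomial_mass m) G \<eta>"
  have "(\<Sum>k\<in>UNIV. mean_count m G \<eta> k)
      = (\<Sum>x\<in>multinomial_outcomes m. ?w x * real (\<Sum>k\<in>UNIV. complete_count m x k))"
    unfolding mean_count_def by (subst sum.swap) (simp add: sum_distrib_left)
  also have "\<dots> = m"
    by (simp add: sum_complete_count sum_em_weight_multinomial flip: sum_distrib_right)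
  finally show ?thesis .
qed

text \<open>All masses are positive here, so every extended logarithm is finite and splits. The
  first sum does not depend on \<open>\<eta>'\<close>; swapping the sums over outcomes and
  coordinates produces the mean counts.\<close>

lemma em_objective_interior:
  assumes "\<eta>' \<in> interior solid_simplex"
  shows "em_objective (multinomial_outcomes m) (multinomial_mass m) G \<eta> \<eta>' =
    ereal (- (\<Sum>x\<in>multinomial_outcomes m. em_weight (multinomial_outcomes m) (multinomial_mass m) G \<eta> x
                * (ln (G x) + ln (fact m / (\<Prod>k\<in>UNIV. fact (complete_count m x k)))))
           - (\<Sum>k\<in>UNIV. mean_count m G \<eta> k * ln (complete_point \<eta>' $ k)))"
proof -
  let ?X = "multinomial_outcomes m" and ?p = "multinomial_mass m"
  let ?w = "em_weight ?X ?p G \<eta>"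
  let ?C = "\<lambda>x. ln (G x) + ln (fact m / (\<Prod>k\<in>UNIV. fact (complete_count m x k)))"
  have "ereal (?w x) * ln_ext (G x * ?p \<eta>' x)
      = ereal (?w x * ?C x + (\<Sum>k\<in>UNIV. ?w x * complete_count m x k * ln (complete_point \<eta>' $ k)))"
    if "x \<in> ?X" for x
    using G_pos[OF that] multinomial_mass_pos[OF assms, of m x] ln_multinomial_mass[OF assms, of m x]
    by (simp add: ln_ext_def ln_mult_pos sum_distrib_left distrib_left mult.assoc)
  moreover have "(\<Sum>x\<in>?X. \<Sum>k\<in>UNIV. ?w x * complete_count m x k * ln (complete_point \<eta>' $ k))
      = (\<Sum>k\<in>UNIV. mean_count m G \<eta> k * ln (complete_point \<eta>' $ k))"
    unfolding mean_count_def by (subst sum.swap) (simp add: sum_distrib_right)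
  ultimately show ?thesis
    unfolding em_objective_def by (simp add: sum.distrib)
qed

text \<open>Some coordinate vanishes, and by \<open>1 \<le> m\<close> the outcome concentrated there
  has mass zero. Its positive weight makes its summand \<open>-\<infinity>\<close>, while no summand
  is \<open>\<infinity>\<close>.\<close>

lemma em_objective_boundary:
  assumes "\<eta>' \<in> solid_simplex" "\<eta>' \<notin> interior solid_simplex"
  shows "em_objective (multinomial_outcomes m) (multinomial_mass m) G \<eta> \<eta>' = \<infinity>"
proof -
  let ?X = "multinomial_outcomes m" and ?p = "multinomial_mass m"
  obtain k where "complete_point \<eta>' $ k = 0"
    using assms by (metis mem_interior_solid_simplex_iff mem_solid_simplex_iff order_le_less)
  moreover obtain y :: "nat^'n" where y: "y \<in> ?X" "complete_count m y k = m"
    by (rule ex_concentrated_outcome)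
  ultimately have "?p \<eta>' y = 0"
    using m_pos by (auto simp: multinomial_mass_eq multinomial_weight_def intro!: bexI[of _ k])
  then have "ereal (em_weight ?X ?p G \<eta> y) * ln_ext (G y * ?p \<eta>' y) = -\<infinity>"
    using em_weight_multinomial_pos[OF y(1)] by (simp add: ln_ext_def)
  moreover have "ereal (em_weight ?X ?p G \<eta> x) * ln_ext (G x * ?p \<eta>' x) \<noteq> \<infinity>" if "x \<in> ?X" for x
    using em_weight_multinomial_pos[OF that] by (simp add: ln_ext_def)
  ultimately show ?thesis
    unfolding em_objective_def
    by (subst sum_ereal_eq_MInfty[where x = y]) (auto simp: finite_multinomial_outcomes y)
qed

text \<open>A minimizer is compared with an explicit interior candidate: the finite value there
  excludes the boundary, and Gibbs' inequality then forces equality.\<close>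

lemma em_minimizer_multinomial:
  assumes "is_arg_min (em_objective (multinomial_outcomes m) (multinomial_mass m) G \<eta>)
    (\<lambda>\<eta>. \<eta> \<in> solid_simplex) \<eta>'"
  shows "\<eta>' \<in> interior solid_simplex"
    and "complete_point \<eta>' $ k = mean_count m G \<eta> k / m"
proof -
  let ?obj = "em_objective (multinomial_outcomes m) (multinomial_mass m) G \<eta>"
  let ?c = "mean_count m G \<eta>"
  \<comment> \<open>The normalized mean counts; they are positive and sum to one, so
    \<open>\<xi>\<close> is interior.\<close>
  define \<xi> :: "real^'n" where "\<xi> = (\<chi> j. ?c (Some j) / m)"
  have "(\<Sum>j\<in>UNIV. ?c (Some j)) = m - ?c None"
    using sum_mean_count by (simp add: sum_UNIV_option)
  then have \<xi>: "complete_point \<xi> $ k = ?c k / m" for k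
    using m_pos by (simp add: \<xi>_def complete_point_def diff_divide_distrib
        flip: sum_divide_distrib split: option.split)
  then have \<xi>_int: "\<xi> \<in> interior solid_simplex"
    using mean_count_pos m_pos by (simp add: mem_interior_solid_simplex_iff)
  then have "\<xi> \<in> solid_simplex"
    using interior_subset by blast
  then have le: "?obj \<eta>' \<le> ?obj \<xi>"
    using assms by (auto simp: is_arg_min_def not_less)
  show int: "\<eta>' \<in> interior solid_simplex"
  proof (rule ccontr)
    assume "\<eta>' \<notin> interior solid_simplex"
    then have "?obj \<eta>' = \<infinity>"
      using assms em_objective_boundary by (simp add: is_arg_min_def)
    then show False
      using le by (simp add: em_objective_interior[OF \<xi>_int])
  qed
  show "complete_point \<eta>' $ k = ?c k / m"
  proof (rule gibbs_maximizer_unique[where c = ?c])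
    \<comment> \<open>Both objective values share the same additive constant, which cancels.\<close>
    show "(\<Sum>k\<in>UNIV. ?c k * ln (?c k / m)) \<le> (\<Sum>k\<in>UNIV. ?c k * ln (complete_point \<eta>' $ k))"
      using le by (simp add: em_objective_interior[OF \<xi>_int] em_objective_interior[OF int] \<xi>)
  qed (use int in \<open>auto simp: mean_count_pos sum_mean_count mem_interior_solid_simplex_iff\<close>)
qed

text \<open>The derivative of \<open>- ln E[G]\<close> is minus the mean of the score under the
  weights \<open>q\<close>, and the score is linear in the counts.\<close>

lemma partial_deriv_neg_ln_expect:
  assumes f: "\<And>\<xi>. \<xi> \<in> interior solid_simplex \<Longrightarrow>
    f \<xi> = - ln (expect (multinomial_outcomes m) (multinomial_mass m) \<xi> G)"
  shows "partial_deriv j f \<eta> =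
    mean_count m G \<eta> None / complete_point \<eta> $ None - mean_count m G \<eta> (Some j) / \<eta> $ j"
proof -
  let ?X = "multinomial_outcomes m" and ?p = "multinomial_mass m"
  let ?E = "expect ?X ?p \<eta> G"
  have "((\<lambda>s. expect ?X ?p (\<eta> + s *\<^sub>R axis j 1) G) has_real_derivative
      (\<Sum>x\<in>?X. ?p \<eta> x * multinomial_score m \<eta> j x * G x)) (at 0)"
    unfolding expect_def
    by (intro DERIV_sum DERIV_cmult_right has_real_derivative_multinomial_mass interior)
  then have "((\<lambda>s. - ln (expect ?X ?p (\<eta> + s *\<^sub>R axis j 1) G)) has_real_derivative
      - ((\<Sum>x\<in>?X. ?p \<eta> x * multinomial_score m \<eta> j x * G x) / ?E)) (at 0)"
    using expect_multinomial_pos by (auto intro!: derivative_eq_intros)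
  moreover have "\<forall>\<^sub>F s in nhds 0. f (\<eta> + s *\<^sub>R axis j 1) = - ln (expect ?X ?p (\<eta> + s *\<^sub>R axis j 1) G)"
    using eventually_shift_interior[OF interior, of "axis j 1"] by eventually_elim (rule f)
  ultimately have "((\<lambda>s. f (\<eta> + s *\<^sub>R axis j 1)) has_real_derivative
      - ((\<Sum>x\<in>?X. ?p \<eta> x * multinomial_score m \<eta> j x * G x) / ?E)) (at 0)"
    by (subst DERIV_cong_ev[OF refl _ refl])
  then have "partial_deriv j f \<eta> = - ((\<Sum>x\<in>?X. ?p \<eta> x * multinomial_score m \<eta> j x * G x) / ?E)"
    unfolding partial_deriv_def by (rule DERIV_imp_deriv)
  \<comment> \<open>Mass times \<open>G x\<close> divided by \<open>?E\<close> is exactly the EM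
    weight.\<close>
  also have "(\<Sum>x\<in>?X. ?p \<eta> x * multinomial_score m \<eta> j x * G x) / ?E
      = (\<Sum>x\<in>?X. \<Sum>k\<in>UNIV. em_weight ?X ?p G \<eta> x * complete_count m x k
          * (score_coeff j k / complete_point \<eta> $ k))"
    by (simp add: multinomial_score_def em_weight_def sum_distrib_left sum_distrib_right
        sum_divide_distrib mult_ac)
  also have "\<dots> = (\<Sum>k\<in>UNIV. mean_count m G \<eta> k * (score_coeff j k / complete_point \<eta> $ k))"
    unfolding mean_count_def by (subst sum.swap) (simp add: sum_distrib_right sum_divide_distrib)
  also have "\<dots> = mean_count m G \<eta> (Some j) / \<eta> $ j - mean_count m G \<eta> None / complete_point \<eta> $ None"
    using sum_mult_score_coeff[of "\<lambda>k. mean_count m G \<eta> k / complete_point \<eta> $ k" j]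
    by (simp add: complete_point_def)
  finally show ?thesis
    by simp
qed

lemma em_step_eq_natural_gradient_update:
  assumes f: "\<And>\<xi>. \<xi> \<in> interior solid_simplex \<Longrightarrow>
      f \<xi> = - ln (expect (multinomial_outcomes m) (multinomial_mass m) \<xi> G)"
    and "is_arg_min (em_objective (multinomial_outcomes m) (multinomial_mass m) G \<eta>)
      (\<lambda>\<eta>. \<eta> \<in> solid_simplex) \<eta>'"
  shows "\<eta>' = natural_gradient_update (multinomial_outcomes m) (multinomial_mass m) f \<eta>"
proof -
  let ?c = "mean_count m G \<eta>"
  define \<eta>\<^sub>0 where "\<eta>\<^sub>0 = complete_point \<eta> $ None"
  have pos: "0 < complete_point \<eta> $ k" for k
    using interior by (simp add: mem_interior_solid_simplex_iff)
  have nz: "\<eta> $ i \<noteq> 0" for i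
    using pos[of "Some i"] by (simp add: complete_point_def)
  have nz0: "\<eta>\<^sub>0 \<noteq> 0" and sum_\<eta>: "(\<Sum>k\<in>UNIV. \<eta> $ k) = 1 - \<eta>\<^sub>0"
    using pos[of None] by (simp_all add: \<eta>\<^sub>0_def complete_point_def)
  have pd: "partial_deriv j f \<eta> = ?c None / \<eta>\<^sub>0 - ?c (Some j) / \<eta> $ j" for j
    using partial_deriv_neg_ln_expect[of f, OF f] by (simp add: \<eta>\<^sub>0_def)
  have "(\<Sum>k\<in>UNIV. \<eta> $ k * partial_deriv k f \<eta>) = (\<Sum>k\<in>UNIV. \<eta> $ k * (?c None / \<eta>\<^sub>0) - ?c (Some k))"
    by (simp add: pd right_diff_distrib nz)
  also have "\<dots> = (1 - \<eta>\<^sub>0) * (?c None / \<eta>\<^sub>0) - (m - ?c None)"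
  proof -
    have "(\<Sum>k\<in>UNIV. ?c (Some k)) = m - ?c None"
      using sum_mean_count by (simp add: sum_UNIV_option)
    then show ?thesis
      by (simp only: sum_subtractf sum_\<eta> flip: sum_distrib_right)
  qed
  also have "\<dots> = ?c None / \<eta>\<^sub>0 - m"
    using nz0 by (simp add: field_simps)
  finally have V: "(\<Sum>k\<in>UNIV. \<eta> $ k * partial_deriv k f \<eta>) = ?c None / \<eta>\<^sub>0 - m" .
  \<comment> \<open>By \<open>pd\<close> and \<open>V\<close> the bracket in the explicit update is
    \<open>m - ?c (Some j) / \<eta> $ j\<close>, so the terms \<open>\<eta> $ j\<close>
    cancel.\<close>
  have "natural_gradient_update (multinomial_outcomes m) (multinomial_mass m) f \<eta> $ j
      = ?c (Some j) / m" for j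
    unfolding natural_gradient_update_multinomial(2)[OF interior m_pos] V unfolding pd
    using nz m_pos by (simp add: right_diff_distrib)
  moreover have "\<eta>' $ j = ?c (Some j) / m" for j
    using em_minimizer_multinomial(2)[OF assms(2), of "Some j"] by (simp add: complete_point_def)
  ultimately show ?thesis
    by (simp add: vec_eq_iff)
qed

end

text \<open>Invertibility is part of the conclusion because \<open>matrix_inv\<close> of a singular
  matrix is an arbitrary value. The second conjunct identifies each EM iterate with the update
  before stating its coordinates.\<close>

theorem corollary4p7:
  fixes I m :: nat and a :: "nat \<Rightarrow> real" and N :: "nat \<Rightarrow> 'n::finite option \<Rightarrow> nat"
    and K :: real and f :: "real^'n \<Rightarrow> real"
    and \<Theta> :: "(real^'n) set" and X :: "(nat^'n) set" and p :: "real^'n \<Rightarrow> nat^'n \<Rightarrow> real"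
  assumes "1 \<le> I"
    and "Sup (poly_fun I a N ` unit_simplex) < K"
    and "1 \<le> m"
    and "Max ((\<lambda>i. \<Sum>j\<in>UNIV. N i j) ` {1..I}) \<le> m"
    and "f = log_objective I a N K"
    and "\<Theta> = solid_simplex"
    and "X = multinomial_outcomes m"
    and "p = multinomial_mass m"
  shows
    "(\<forall>\<eta>\<in>interior \<Theta>.
        invertible (fisher_information X p \<eta>) \<and>
        (\<forall>j. natural_gradient_update X p f \<eta> $ j =
             \<eta> $ j - \<eta> $ j / real m *
               (partial_deriv j f \<eta> - (\<Sum>k\<in>UNIV. \<eta> $ k * partial_deriv k f \<eta>)))) \<and>
     (\<forall>G \<theta>. em_run \<Theta> f X p G \<theta> \<longrightarrow>
        (\<forall>t\<ge>1.
           \<theta> (t - 1) \<in> interior \<Theta> \<and>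
           \<theta> t = natural_gradient_update X p f (\<theta> (t - 1)) \<and>
           (\<forall>j. \<theta> t $ j =
             \<theta> (t - 1) $ j - \<theta> (t - 1) $ j / real m *
               (partial_deriv j f (\<theta> (t - 1)) -
                (\<Sum>k\<in>UNIV. \<theta> (t - 1) $ k * partial_deriv k f (\<theta> (t - 1)))))))"
proof (unfold assms(6-8), intro conjI ballI allI impI)
  note update = natural_gradient_update_multinomial[OF _ assms(3)]
  fix \<eta> :: "real^'n" and j
  assume "\<eta> \<in> interior solid_simplex"
  then show "invertible (fisher_information (multinomial_outcomes m) (multinomial_mass m) \<eta>)"
    and "natural_gradient_update (multinomial_outcomes m) (multinomial_mass m) f \<eta> $ j =
      \<eta> $ j - \<eta> $ j / real m *
        (partial_deriv j f \<eta> - (\<Sum>k\<in>UNIV. \<eta> $ k * partial_deriv k f \<eta>))"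
    by (rule update)+
next
  fix G \<theta> and t :: nat and j
  assume run: "em_run solid_simplex f (multinomial_outcomes m) (multinomial_mass m) G \<theta>"
    and "1 \<le> t"
  have G_pos: "\<And>x. x \<in> multinomial_outcomes m \<Longrightarrow> 0 < G x"
    and f: "\<And>\<xi>. \<xi> \<in> interior solid_simplex \<Longrightarrow>
      f \<xi> = - ln (expect (multinomial_outcomes m) (multinomial_mass m) \<xi> G)"
    and start: "\<theta> 0 \<in> interior solid_simplex"
    and step: "\<And>t. 1 \<le> t \<Longrightarrow>
      is_arg_min (em_objective (multinomial_outcomes m) (multinomial_mass m) G (\<theta> (t - 1)))
        (\<lambda>\<eta>. \<eta> \<in> solid_simplex) (\<theta> t)"
    using run by (auto simp: em_run_def)
  \<comment> \<open>The EM step formulas require an interior current iterate; interiority passes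
    from each iterate to the next because every minimizer is interior.\<close>
  have int: "\<theta> s \<in> interior solid_simplex" for s
  proof (induction s)
    case (Suc s)
    then show ?case
      using em_minimizer_multinomial(1)[OF G_pos Suc.IH assms(3)] step[of "Suc s"] by simp
  qed (rule start)
  then show "\<theta> (t - 1) \<in> interior solid_simplex" .
  show eq: "\<theta> t = natural_gradient_update (multinomial_outcomes m) (multinomial_mass m) f (\<theta> (t - 1))"
    by (rule em_step_eq_natural_gradient_update[OF G_pos int assms(3) f step[OF \<open>1 \<le> t\<close>]])
  show "\<theta> t $ j = \<theta> (t - 1) $ j - \<theta> (t - 1) $ j / real m *
      (partial_deriv j f (\<theta> (t - 1)) - (\<Sum>k\<in>UNIV. \<theta> (t - 1) $ k * partial_deriv k f (\<theta> (t - 1))))"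
    unfolding eq by (rule natural_gradient_update_multinomial(2)[OF int assms(3)])
qed

end
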